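(* If $\Sigma_A^\alpha[1]\ne\varnothing$, then $\alpha\in[0,2]$.
   Context: $\Delta$ is the open unit disk in $\mathbb{C}$. $\Sigma[1]$ is the class of univalent holomorphic functions $h:\Delta\to\mathbb{C}$ such that $h(0)=0$, $h(z)+t\in h(\Delta)$ for all $z\in\Delta$, $t\ge0$, and $\lim_{t\to\infty}h^{-1}(h(z)+t)=1$ for all $z\in\Delta$. For a real number $\alpha\ge0$, $\Sigma_A^\alpha[1]$ is the class of those $h\in\Sigma[1]$ for which the angular (nontangential) limit $\mu=\angle\lim_{z\to1}(1-z)^{1+\alpha}h'(z)$ exists, is finite and is different from zero. Powers of $1-z$ are taken with the principal branch. *)

theory Defs
  imports "HOL-Complex_Analysis.Complex_Analysis"
begin

abbreviation unit_disk :: "complex set" where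
  "unit_disk \<equiv> ball 0 1"

text \<open>For \<open>M \<le> 1\<close> the region below is empty; for \<open>M > 1\<close> these regions are
  the usual nontangential approach regions at the boundary point \<open>\<zeta>\<close>.\<close>

definition stolz_region :: "complex \<Rightarrow> real \<Rightarrow> complex set" where
  "stolz_region \<zeta> M = {z \<in> unit_disk. cmod (\<zeta> - z) < M * (1 - cmod z)}"

definition has_angular_limit ::
    "(complex \<Rightarrow> complex) \<Rightarrow> complex \<Rightarrow> complex \<Rightarrow> bool" where
  "has_angular_limit f \<mu> \<zeta> \<longleftrightarrow>
     (\<forall>M>1. (f \<longlongrightarrow> \<mu>) (at \<zeta> within stolz_region \<zeta> M))"

text \<open>Functions on the disk are represented by total functions whose values outside
  the disk are irrelevant.\<close>

definition Sigma1 :: "(complex \<Rightarrow> complex) set" where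
  "Sigma1 = {h. h holomorphic_on unit_disk \<and> inj_on h unit_disk \<and> h 0 = 0 \<and>
     (\<forall>z\<in>unit_disk. \<forall>t::real. t \<ge> 0 \<longrightarrow> h z + of_real t \<in> h ` unit_disk) \<and>
     (\<forall>z\<in>unit_disk.
        ((\<lambda>t::real. inv_into unit_disk h (h z + of_real t)) \<longlongrightarrow> 1) at_top)}"

definition SigmaA1 :: "real \<Rightarrow> (complex \<Rightarrow> complex) set" where
  "SigmaA1 \<alpha> = {h \<in> Sigma1.
     \<exists>\<mu>. \<mu> \<noteq> 0 \<and>
       has_angular_limit (\<lambda>z. (1 - z) powr of_real (1 + \<alpha>) * deriv h z) \<mu> 1}"

end

theory Submission
  imports Defs
begin

text \<open>
  Blowing up a univalent \<open>h\<close> at the boundary point \<open>1\<close>, the univalent functions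
  \<open>w \<mapsto> t\<^sup>\<alpha> h (1 - t w)\<close> converge as \<open>t \<rightarrow> 0\<close>, up to additive constants and uniformly on
  every disk \<open>ball c r\<close> with \<open>r < c\<close>, to \<open>(\<mu> / \<alpha>) w\<^sup>-\<^sup>\<alpha>\<close>. By Hurwitz's theorem
  \<open>w\<^sup>-\<^sup>\<alpha>\<close> is then injective on each such disk, hence on the right half-plane. But for
  \<open>\<alpha> > 2\<close> the points \<open>exp (\<plusminus> i \<pi> / \<alpha>)\<close> lie in the right half-plane and have the same
  image \<open>-1\<close>.
\<close>

lemma right_half_plane_ball:
  fixes c r :: real
  assumes "w \<in> ball (of_real c) r"
  shows "c - r < Re w" "cmod w < \<bar>c\<bar> + r"
proof -
  have *: "cmod (w - of_real c) < r"
    using assms by (simp add: dist_norm norm_minus_commute)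
  show "c - r < Re w"
    using abs_Re_le_cmod[of "w - of_real c"] * by simp
  show "cmod w < \<bar>c\<bar> + r"
    using norm_triangle_sub[of w "of_real c"] * by simp
qed

text \<open>In the expansion of the squared modulus of \<open>1 - t * w\<close>, the bound
  \<open>t * R\<^sup>2 \<le> d\<close> lets the quadratic term cancel at most half of
  \<open>2 * t * d\<close>. Hence \<open>1 - t * w\<close> lies at least \<open>t * d / 2\<close>
  inside the circle, while its distance to 1 is below \<open>t * R\<close>. The quotient of the two
  bounds is the aperture \<open>2 * R / d\<close>, which is independent of \<open>t\<close>.\<close>

lemma one_minus_mult_in_stolz_region:
  assumes d: "0 < d" "d \<le> Re w" and R: "cmod w < R"
    and t: "0 < t" "t \<le> d / R\<^sup>2"
  shows "1 - of_real t * w \<in> stolz_region 1 (2 * R / d)"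
proof -
  have dR: "d < R"
    using d R complex_Re_le_cmod[of w] by linarith
  with d have R0: "0 < R" by linarith
  have tR: "t * R\<^sup>2 \<le> d"
    using t R0 by (simp add: field_simps)
  \<comment> \<open>This makes \<open>1 - t * d / 2\<close> nonnegative, as required for comparing
    square roots below.\<close>
  have td: "t * d \<le> 1"
  proof -
    have "t * d * d \<le> t * R\<^sup>2"
      using d t dR by (simp add: power2_eq_square mult_mono)
    also have "\<dots> \<le> 1 * d" using tR by simp
    finally show ?thesis using d by (simp only: mult_le_cancel_right_pos)
  qed
  have "(cmod (1 - of_real t * w))\<^sup>2 = 1 - 2 * t * Re w + t * (t * (cmod w)\<^sup>2)"
    unfolding cmod_power2 by (simp add: power2_eq_square algebra_simps)
  also have "\<dots> \<le> 1 - 2 * t * d + t * (t * R\<^sup>2)"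
  proof -
    have "t * (t * (cmod w)\<^sup>2) \<le> t * (t * R\<^sup>2)"
      using t R by (intro mult_left_mono power_mono) auto
    moreover have "t * d \<le> t * Re w" using d t by simp
    ultimately show ?thesis by linarith
  qed
  also have "\<dots> \<le> 1 - 2 * t * d + t * d"
    using tR t by simp
  also have "\<dots> \<le> (1 - t * d / 2)\<^sup>2"
    using zero_le_square[of "t * d"] by (simp add: power2_eq_square algebra_simps)
  finally have le: "cmod (1 - of_real t * w) \<le> 1 - t * d / 2"
    by (rule power2_le_imp_le) (use td in linarith)
  have "0 < t * d" using t d by simp
  with le have "cmod (1 - of_real t * w) < 1" by linarith
  moreover have "cmod (1 - (1 - of_real t * w)) < 2 * R / d * (1 - cmod (1 - of_real t * w))"
  proof -
    have "cmod (1 - (1 - of_real t * w)) = t * cmod w"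
      using t by (simp add: norm_mult)
    also have "\<dots> < t * R" using t R by simp
    also have "\<dots> = 2 * R / d * (t * d / 2)" using d by simp
    also have "\<dots> \<le> 2 * R / d * (1 - cmod (1 - of_real t * w))"
      using le d R0 by (intro mult_left_mono) auto
    finally show ?thesis .
  qed
  ultimately show ?thesis by (simp add: stolz_region_def)
qed

text \<open>The disk is bounded and stays away from the imaginary axis, so for small
  \<open>t\<close> one single Stolz region contains all points \<open>1 - t * w\<close>. This turns
  the angular limit into a limit uniform in \<open>w\<close>.\<close>

lemma angular_limit_blow_up:
  fixes c r :: real
  assumes lim: "has_angular_limit f \<mu> 1" and r: "0 < r" "r < c" and "0 < \<epsilon>"
  shows "\<forall>\<^sub>F t :: real in at_right 0. \<forall>w \<in> ball (of_real c) r. cmod (f (1 - of_real t * w) - \<mu>) < \<epsilon>"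
proof -
  define d R where "d = c - r" and "R = c + r"
  have d: "0 < d" "0 < R" "d < R" using r by (auto simp: d_def R_def)
  have "(f \<longlongrightarrow> \<mu>) (at 1 within stolz_region 1 (2 * R / d))"
    using lim d by (auto simp: has_angular_limit_def)
  then obtain \<delta> where \<delta>: "0 < \<delta>"
    and near: "\<And>z. z \<in> stolz_region 1 (2 * R / d) \<Longrightarrow> z \<noteq> 1 \<Longrightarrow> dist z 1 < \<delta> \<Longrightarrow> dist (f z) \<mu> < \<epsilon>"
    using \<open>0 < \<epsilon>\<close> unfolding Lim_within by (metis zero_less_dist_iff)
  \<comment> \<open>The first bound puts \<open>1 - t * w\<close> into the Stolz region, the second
    puts it within \<delta> of 1.\<close>
  have "0 < min (d / R\<^sup>2) (\<delta> / R)" using d \<delta> by simp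
  then have "\<forall>\<^sub>F t in at_right 0. t < min (d / R\<^sup>2) (\<delta> / R)"
    by (rule order_tendstoD(2)[OF tendsto_ident_at])
  then show ?thesis
    using eventually_at_right_less[of 0]
  proof eventually_elim
    case (elim t)
    show ?case
    proof
      fix w :: complex assume "w \<in> ball (of_real c) r"
      from right_half_plane_ball[OF this] have w: "d < Re w" "cmod w < R"
        using r by (auto simp: d_def R_def)
      have "1 - of_real t * w \<in> stolz_region 1 (2 * R / d)"
        using one_minus_mult_in_stolz_region[of d w R t] d w elim by auto
      moreover have "1 - of_real t * w \<noteq> 1" using w d elim by auto
      moreover have "dist (1 - of_real t * w) 1 < \<delta>"
      proof -
        have "dist (1 - of_real t * w) 1 = t * cmod w"
          using elim by (simp add: dist_norm norm_mult)
        also have "\<dots> < t * R" using w elim by simp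
        also have "\<dots> < \<delta>" using elim d by (simp add: field_simps)
        finally show ?thesis .
      qed
      ultimately show "cmod (f (1 - of_real t * w) - \<mu>) < \<epsilon>"
        using near by (simp add: dist_norm)
    qed
  qed
qed

text \<open>The derivatives of the rescaled functions converge uniformly on the disk. Subtracting
  the values at the centre fixes the additive constants, so the functions converge uniformly too,
  and Hurwitz's theorem applies to the limit.\<close>

lemma inj_on_powr_of_angular_limit:
  fixes \<alpha> c r :: real
  assumes holh: "h holomorphic_on unit_disk" and injh: "inj_on h unit_disk"
    and lim: "has_angular_limit (\<lambda>z. (1 - z) powr of_real (1 + \<alpha>) * deriv h z) \<mu> 1"
    and "\<mu> \<noteq> 0" "0 < \<alpha>" and r: "0 < r" "r < c"
  shows "inj_on (\<lambda>w. w powr of_real (-\<alpha>)) (ball (complex_of_real c) r)"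
proof -
  define S where "S = ball (complex_of_real c) r"
  define d where "d = c - r"
  define B where "B = d powr (-1 - \<alpha>)"
  define t\<^sub>0 where "t\<^sub>0 = d / (c + r)\<^sup>2"
  \<comment> \<open>The chain rule supplies one more factor \<open>t\<close>, which completes the
    weight \<open>t powr (1 + \<alpha>)\<close> of the angular limit at
    \<open>1 - z = t * w\<close>. Both \<open>F t\<close> and \<open>G\<close> vanish at
    \<open>c\<close>.\<close>
  define F where "F t w = of_real (t powr \<alpha>) * (h (1 - of_real t * w) - h (1 - of_real t * of_real c))"
    for t :: real and w
  define G where "G w = \<mu> / of_real \<alpha> * (w powr of_real (-\<alpha>) - of_real c powr of_real (-\<alpha>))"
    for w :: complex
  define G' where "G' w = - \<mu> * w powr of_real (-1 - \<alpha>)" for w :: complex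
  have S: "open S" "connected S" "convex S" "of_real c \<in> S"
    using r by (auto simp: S_def)
  have d0: "0 < d" and t\<^sub>0: "0 < t\<^sub>0" and B0: "0 < B"
    using r by (auto simp: d_def t\<^sub>0_def B_def)
  have ReS: "d < Re w" if "w \<in> S" for w
    using right_half_plane_ball(1)[of w c r] that by (simp add: S_def d_def)
  have nonpos: "w \<notin> \<real>\<^sub>\<le>\<^sub>0" if "w \<in> S" for w
    using ReS[OF that] d0 by (auto simp: complex_nonpos_Reals_iff)
  have disk: "1 - of_real t * w \<in> unit_disk" if "w \<in> S" "0 < t" "t \<le> t\<^sub>0" for t w
    using one_minus_mult_in_stolz_region[of d w "c + r" t] right_half_plane_ball[of w c r] that r d0
    by (auto simp: S_def d_def t\<^sub>0_def stolz_region_def)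
  have derG: "(G has_field_derivative G' w) (at w)" if "w \<in> S" for w
  proof -
    have "(G has_field_derivative \<mu> / of_real \<alpha> *
        (of_real (-\<alpha>) * w powr (of_real (-\<alpha>) - 1) - 0)) (at w)"
      unfolding G_def
      by (intro DERIV_cmult DERIV_diff DERIV_const has_field_derivative_powr nonpos that)
    moreover have "of_real (-\<alpha>) - 1 = complex_of_real (-1 - \<alpha>)" by simp
    moreover have "\<mu> / of_real \<alpha> * (of_real (-\<alpha>) * z - 0) = - \<mu> * z" for z
      using \<open>0 < \<alpha>\<close> by simp
    ultimately show ?thesis
      by (simp only: G'_def)
  qed
  have derF: "(F t has_field_derivative - of_real (t powr (1 + \<alpha>)) * deriv h (1 - of_real t * w)) (at w)"
    if "w \<in> S" "0 < t" "t \<le> t\<^sub>0" for t w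
  proof -
    have "(h has_field_derivative deriv h (1 - of_real t * w)) (at (1 - of_real t * w))"
      using holh disk[OF that] by (intro holomorphic_derivI[of h unit_disk]) auto
    then have "((\<lambda>w. h (1 - of_real t * w)) has_field_derivative
        deriv h (1 - of_real t * w) * (- of_real t)) (at w)"
      by (rule DERIV_chain2) (auto intro!: derivative_eq_intros)
    then have "(F t has_field_derivative
        of_real (t powr \<alpha>) * (deriv h (1 - of_real t * w) * (- of_real t))) (at w)"
      unfolding F_def by (auto intro!: derivative_eq_intros)
    then show ?thesis
      using that by (simp add: powr_add mult_ac)
  qed
  have near: "cmod (- of_real (t powr (1 + \<alpha>)) * deriv h (1 - of_real t * w) - G' w) \<le> B * \<epsilon>"
    if w: "w \<in> S" and t: "0 < t"
      and le: "cmod ((of_real t * w) powr of_real (1 + \<alpha>) * deriv h (1 - of_real t * w) - \<mu>) \<le> \<epsilon>"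
    for t w \<epsilon>
  proof -
    have w0: "w \<noteq> 0" using ReS[OF w] d0 by auto
    have inv: "w powr of_real (1 + \<alpha>) * w powr of_real (-1 - \<alpha>) = 1"
      using w0 by (simp flip: powr_add)
    have "(of_real t * w) powr of_real (1 + \<alpha>) = of_real (t powr (1 + \<alpha>)) * w powr of_real (1 + \<alpha>)"
      \<comment> \<open>The principal power splits here because \<open>t\<close> is a positive real,
        so no argument is shifted.\<close>
      using t powr_times_real_left[of "of_real t" w "of_real (1 + \<alpha>)"]
        powr_of_real[of t "1 + \<alpha>"] by simp
    moreover have "- T * D - - \<mu> * Q = - Q * (T * P * D - \<mu>)" if "P * Q = 1" for T D P Q :: complex
      using that by algebra
    ultimately have "- of_real (t powr (1 + \<alpha>)) * deriv h (1 - of_real t * w) - G' w =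
        - (w powr of_real (-1 - \<alpha>)) *
          ((of_real t * w) powr of_real (1 + \<alpha>) * deriv h (1 - of_real t * w) - \<mu>)"
      unfolding G'_def using inv by metis
    then have "cmod (- of_real (t powr (1 + \<alpha>)) * deriv h (1 - of_real t * w) - G' w) =
        cmod (w powr of_real (-1 - \<alpha>)) *
        cmod ((of_real t * w) powr of_real (1 + \<alpha>) * deriv h (1 - of_real t * w) - \<mu>)"
      by (simp only: norm_mult norm_minus_cancel)
    also have "\<dots> \<le> B * \<epsilon>"
    proof (rule mult_mono)
      have "d \<le> cmod w"
        using ReS[OF w] complex_Re_le_cmod[of w] by linarith
      then show "cmod (w powr of_real (-1 - \<alpha>)) \<le> B"
        unfolding B_def using d0 \<open>0 < \<alpha>\<close> by (subst norm_powr_real_powr') (auto intro: powr_mono2')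
    qed (use le B0 in auto)
    finally show ?thesis .
  qed
  \<comment> \<open>Starting at \<open>t\<^sub>0\<close> keeps every \<open>F (t n)\<close>, not
    only those with large \<open>n\<close>, holomorphic and injective on \<open>S\<close>.\<close>
  define t where "t n = t\<^sub>0 / real (Suc n)" for n
  have t: "0 < t n" "t n \<le> t\<^sub>0" for n
    using t\<^sub>0 by (auto simp: t_def field_simps)
  have tlim: "filterlim t (at_right 0) sequentially"
  proof -
    have "t \<longlonglongrightarrow> 0" unfolding t_def
      using tendsto_mult[OF tendsto_const LIMSEQ_inverse_real_of_nat, of t\<^sub>0]
      by (simp add: divide_inverse)
    then show ?thesis
      using t(1) by (simp add: filterlim_at less_imp_neq[symmetric])
  qed
  have unif: "uniform_limit S (\<lambda>n. F (t n)) G sequentially"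
  proof (rule uniform_limitI)
    fix \<epsilon> :: real assume "0 < \<epsilon>"
    define \<eta> where "\<eta> = \<epsilon> / (2 * B * r)"
    have "0 < \<eta>" using \<open>0 < \<epsilon>\<close> B0 r by (simp add: \<eta>_def)
    have "\<forall>\<^sub>F n in sequentially. \<forall>w\<in>S.
        cmod ((1 - (1 - of_real (t n) * w)) powr of_real (1 + \<alpha>) * deriv h (1 - of_real (t n) * w) - \<mu>) < \<eta>"
      using filterlim_iff[THEN iffD1, OF tlim, rule_format,
          OF angular_limit_blow_up[OF lim r \<open>0 < \<eta>\<close>]]
      by (simp add: S_def)
    then show "\<forall>\<^sub>F n in sequentially. \<forall>w\<in>S. dist (F (t n) w) (G w) < \<epsilon>"
    proof eventually_elim
      case (elim n)
      show ?case
      proof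
        fix w assume w: "w \<in> S"
        \<comment> \<open>The mean value inequality on the convex set \<open>S\<close>, applied from
          the centre. The choice of \<eta> makes the resulting bound \<open>B * \<eta> * r\<close>
          equal to \<open>\<epsilon> / 2\<close>.\<close>
        have "cmod ((F (t n) w - G w) - (F (t n) (of_real c) - G (of_real c)))
            \<le> (B * \<eta>) * cmod (w - of_real c)"
        proof (rule field_differentiable_bound[OF \<open>convex S\<close>])
          fix z assume z: "z \<in> S"
          show "((\<lambda>w. F (t n) w - G w) has_field_derivative
              (- of_real (t n powr (1 + \<alpha>)) * deriv h (1 - of_real (t n) * z) - G' z)) (at z within S)"
            by (intro DERIV_diff has_field_derivative_at_within[OF derF]
                has_field_derivative_at_within[OF derG] z t)
          show "cmod (- of_real (t n powr (1 + \<alpha>)) * deriv h (1 - of_real (t n) * z) - G' z) \<le> B * \<eta>"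
            using elim z by (intro near t) (auto intro: less_imp_le)
        qed (use w S in auto)
        also have "\<dots> \<le> (B * \<eta>) * r"
          using w B0 \<open>0 < \<eta>\<close>
          by (intro mult_left_mono) (auto simp: S_def dist_norm norm_minus_commute)
        also have "\<dots> < \<epsilon>"
          using B0 r \<open>0 < \<epsilon>\<close> by (simp add: \<eta>_def)
        finally show "dist (F (t n) w) (G w) < \<epsilon>"
          by (simp add: dist_norm F_def G_def)
      qed
    qed
  qed
  have "inj_on G S"
  proof (rule Hurwitz_injective[OF S(1,2)])
    show "F (t n) holomorphic_on S" for n
      using derF t S(1) by (subst holomorphic_on_open) blast+
    show "G holomorphic_on S"
      using derG S(1) by (subst holomorphic_on_open) blast+
    show "uniform_limit K (\<lambda>n. F (t n)) G sequentially" if "K \<subseteq> S" for K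
      using unif that by (rule uniform_limit_on_subset)
    \<comment> \<open>A constant limit is excluded because \<open>G'\<close> at \<open>c\<close> is
      a nonzero multiple of \<mu>.\<close>
    show "\<not> G constant_on S"
    proof
      assume "G constant_on S"
      then obtain a where "\<And>w. w \<in> S \<Longrightarrow> G w = a"
        by (auto simp: constant_on_def)
      then have "(G has_field_derivative 0) (at (of_real c))"
        using S by (intro has_field_derivative_transform_within_open[OF DERIV_const[of a]]) auto
      then have "G' (of_real c) = 0"
        using derG[OF S(4)] DERIV_unique by blast
      then show False
        using \<open>\<mu> \<noteq> 0\<close> r by (simp add: G'_def)
    qed
    show "inj_on (F (t n)) S" for n
    proof (rule inj_onI)
      fix x y assume xy: "x \<in> S" "y \<in> S" "F (t n) x = F (t n) y"
      then have "h (1 - of_real (t n) * x) = h (1 - of_real (t n) * y)"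
        using t(1)[of n] by (simp add: F_def)
      then have "1 - of_real (t n) * x = 1 - of_real (t n) * y"
        using inj_onD[OF injh] disk xy t by blast
      then show "x = y" using t(1)[of n] by simp
    qed
  qed
  then show ?thesis
    by (auto simp: inj_on_def G_def S_def)
qed

lemma not_inj_on_powr_ball:
  fixes \<alpha> :: real
  assumes "2 < \<alpha>"
  obtains c r where "0 < r" "r < c"
    "\<not> inj_on (\<lambda>w. w powr of_real (-\<alpha>)) (ball (complex_of_real c) r)"
proof -
  define \<theta> where "\<theta> = pi / \<alpha>"
  have \<theta>: "0 < \<theta>" "\<theta> < pi / 2" "\<theta> * \<alpha> = pi"
    using assms by (auto simp: \<theta>_def field_simps)
  have cos: "0 < cos \<theta>" and sin: "0 < sin \<theta>"
    using \<theta> by (auto intro!: cos_gt_zero sin_gt_zero)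
  \<comment> \<open>The tangents to the unit circle at \<open>cis \<theta>\<close> and
    \<open>cis (-\<theta>)\<close> meet at \<open>c\<close>, so both points have squared distance
    \<open>c\<^sup>2 - 1\<close> from it. Any squared radius strictly between
    \<open>c\<^sup>2 - 1\<close> and \<open>c\<^sup>2\<close> gives a disk that contains them and
    stays in the right half-plane.\<close>
  define c where "c = 1 / cos \<theta>"
  define r where "r = sqrt (c\<^sup>2 - 1 / 2)"
  have c: "1 \<le> c" using cos by (simp add: c_def)
  then have c2: "1 \<le> c\<^sup>2" by simp
  have r0: "0 < r" using c2 by (simp add: r_def)
  have rc: "r < c"
    unfolding r_def by (rule real_less_lsqrt) (use c in auto)
  have in_ball: "cis x \<in> ball (of_real c) r" if "cos x = cos \<theta>" for x
  proof -
    have "(cmod (of_real c - cis x))\<^sup>2 = c\<^sup>2 - 2 * (c * cos x) + ((cos x)\<^sup>2 + (sin x)\<^sup>2)"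
      unfolding cmod_power2 by (simp add: power2_eq_square algebra_simps)
    also have "c * cos x = 1" using cos that by (simp add: c_def)
    finally have "(cmod (of_real c - cis x))\<^sup>2 = c\<^sup>2 - 1" by simp
    then have "(cmod (of_real c - cis x))\<^sup>2 < c\<^sup>2 - 1 / 2" by simp
    then have "cmod (of_real c - cis x) < r"
      unfolding r_def by (rule real_less_rsqrt)
    then show ?thesis by (simp add: dist_norm)
  qed
  \<comment> \<open>The bound on \<open>x\<close> keeps the principal logarithm of
    \<open>cis x\<close> equal to \<open>\<i> * x\<close>.\<close>
  have powr: "cis x powr of_real (-\<alpha>) = cis (- (x * \<alpha>))" if "\<bar>x\<bar> < pi / 2" for x
  proof -
    have "Ln (cis x) = \<i> * of_real x"
      unfolding cis_conv_exp using that by (intro Ln_exp) auto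
    then show ?thesis
      by (simp add: powr_def cis_conv_exp mult_ac)
  qed
  have "cis \<theta> powr of_real (-\<alpha>) = cis (-pi)"
    by (subst powr) (use \<theta> in simp_all)
  moreover have "cis (-\<theta>) powr of_real (-\<alpha>) = cis pi"
    by (subst powr) (use \<theta> in simp_all)
  moreover have "cis (-pi) = cis pi"
    by (simp add: complex_eq_iff)
  ultimately have "cis \<theta> powr of_real (-\<alpha>) = cis (-\<theta>) powr of_real (-\<alpha>)"
    by metis
  moreover have "cis \<theta> \<noteq> cis (-\<theta>)"
    using sin by (simp add: complex_eq_iff)
  moreover have "cis \<theta> \<in> ball (of_real c) r" "cis (-\<theta>) \<in> ball (of_real c) r"
    by (simp_all only: in_ball cos_minus)
  ultimately have "\<not> inj_on (\<lambda>w. w powr of_real (-\<alpha>)) (ball (complex_of_real c) r)"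
    by (blast dest: inj_onD)
  with r0 rc show ?thesis by (rule that)
qed

theorem lemma10:
  fixes \<alpha> :: real
  assumes "\<alpha> \<ge> 0"
    and "SigmaA1 \<alpha> \<noteq> {}"
  shows "\<alpha> \<in> {0..2}"
proof (rule ccontr)
  assume "\<alpha> \<notin> {0..2}"
  with assms(1) have \<alpha>: "2 < \<alpha>" by simp
  from assms(2) obtain h \<mu> where h: "h holomorphic_on unit_disk" "inj_on h unit_disk"
    and \<mu>: "\<mu> \<noteq> 0" "has_angular_limit (\<lambda>z. (1 - z) powr of_real (1 + \<alpha>) * deriv h z) \<mu> 1"
    by (auto simp: SigmaA1_def Sigma1_def)
  obtain c r where cr: "0 < r" "r < c"
    and "\<not> inj_on (\<lambda>w. w powr of_real (-\<alpha>)) (ball (complex_of_real c) r)"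
    using not_inj_on_powr_ball[OF \<alpha>] .
  then show False
    using inj_on_powr_of_angular_limit[OF h \<mu>(2,1) _ cr] \<alpha> by linarith
qed

end
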